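(* Let $H=(V,E)$ be a submodular hypergraph on $n$ vertices such that for every $e\in E$ the splitting function $g_e:2^e\to\mathbb{R}^{\ge0}$ is submodular and monotone, and let $0<\varepsilon<1$. Then there exists a $(1\pm\varepsilon)$ cut-sparsifier for $H$ retaining only $\widetilde{O}(n/\varepsilon^2)$ hyperedges.
   Context: A submodular hypergraph $H=(V,E)$ has hyperedges $e\subseteq V$, each with a submodular splitting function $g_e:2^e\to\mathbb{R}^{\ge0}$ and nonnegative weight $w_e$ (weight $1$ if unweighted); for $S\subseteq V$, $\mathrm{cut}_H(S)=\sum_{e\in E}w_e g_e(S\cap e)$. A function $g:2^U\to\mathbb{R}^{\ge0}$ is submodular if $g(S\cup\{x\})-g(S)\ge g(T\cup\{x\})-g(T)$ for all $S\subset T\subset U$, $x\in U\setminus T$, and monotone if $g(S)\le g(T)$ for $S\subseteq T$. A $(1\pm\varepsilon)$ cut-sparsifier of $H$ is a hypergraph $\hat H$ obtained by keeping a subset of the hyperedges of $H$ (with their splitting functions) and assigning them new nonnegative weights, such that $(1-\varepsilon)\mathrm{cut}_H(S)\le\mathrm{cut}_{\hat H}(S)\le(1+\varepsilon)\mathrm{cut}_H(S)$ for all $S\subseteq V$. $\widetilde{O}$ hides polylogarithmic factors. *)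

theory Defs
  imports Complex_Main
begin

text \<open>
  Hyperedges are named by elements of \<open>'e\<close>, so that parallel hyperedges with different splitting
  functions are allowed. A hypergraph whose hyperedges are literally a set of subsets of \<open>V\<close> is the
  case where \<open>ends\<close> is the identity. Only the values of \<open>split H e\<close> on subsets of \<open>ends H e\<close> matter.
\<close>

record ('v, 'e) hypergraph =
  verts :: "'v set"
  edges :: "'e set"
  ends :: "'e \<Rightarrow> 'v set"
  split :: "'e \<Rightarrow> 'v set \<Rightarrow> real"
  weight :: "'e \<Rightarrow> real"

definition submodular_on :: "'v set \<Rightarrow> ('v set \<Rightarrow> real) \<Rightarrow> bool" where
  "submodular_on U g \<longleftrightarrow>
     (\<forall>S T x. S \<subseteq> T \<and> T \<subseteq> U \<and> x \<in> U - T \<longrightarrow>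
        g (S \<union> {x}) - g S \<ge> g (T \<union> {x}) - g T)"

definition monotone_splitting_on :: "'v set \<Rightarrow> ('v set \<Rightarrow> real) \<Rightarrow> bool" where
  "monotone_splitting_on U g \<longleftrightarrow> (\<forall>S T. S \<subseteq> T \<and> T \<subseteq> U \<longrightarrow> g S \<le> g T)"

text \<open>Splitting functions are not required to vanish on the empty set.\<close>

definition submodular_hypergraph :: "('v, 'e) hypergraph \<Rightarrow> bool" where
  "submodular_hypergraph H \<longleftrightarrow>
     finite (verts H) \<and> finite (edges H) \<and>
     (\<forall>e\<in>edges H. ends H e \<subseteq> verts H \<and> weight H e \<ge> 0 \<and>
        (\<forall>S. S \<subseteq> ends H e \<longrightarrow> split H e S \<ge> 0) \<and>
        submodular_on (ends H e) (split H e))"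

definition cut :: "('v, 'e) hypergraph \<Rightarrow> 'v set \<Rightarrow> real" where
  "cut H S = (\<Sum>e\<in>edges H. weight H e * split H e (S \<inter> ends H e))"

definition cut_sparsifier :: "real \<Rightarrow> ('v, 'e) hypergraph \<Rightarrow> ('v, 'e) hypergraph \<Rightarrow> bool" where
  "cut_sparsifier \<epsilon> H H' \<longleftrightarrow>
     verts H' = verts H \<and> edges H' \<subseteq> edges H \<and>
     (\<forall>e\<in>edges H'. ends H' e = ends H e \<and> split H' e = split H e \<and> weight H' e \<ge> 0) \<and>
     (\<forall>S. S \<subseteq> verts H \<longrightarrow>
        (1 - \<epsilon>) * cut H S \<le> cut H' S \<and> cut H' S \<le> (1 + \<epsilon>) * cut H S)"

end

theory Submission
  imports Defs
begin

text \<open>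
  Let \<open>f\<close> be the cut function, and start from the empty set to build a chain \<open>T 0 \<subset> \<dots> \<subset> T L = V\<close>,
  where \<open>T (i + 1)\<close> minimises the density \<open>(f R - f (T i)) / card (R - T i)\<close> over \<open>R \<supset> T i\<close>. The
  minimal densities \<open>d i\<close> increase. A hyperedge \<open>e\<close> with weighted splitting function \<open>g\<close> is kept with
  probability about \<open>K (\<Sum>i. (g (T (i + 1)) - g (T i)) / d i)\<close>, where \<open>K\<close> is of order \<open>log n / \<epsilon>\<^sup>2\<close>;
  these probabilities add up to at most \<open>K n\<close>. Telescoping along the chain writes \<open>f S\<close> as a sum of
  layers, hence as a nonnegative combination of functions
  \<open>F i S = (\<Sum>l\<ge>i. layer l / d l)\<close>. Each \<open>F i S\<close> depends only on \<open>A = S - T i\<close> and is at least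
  \<open>card A\<close>, because every vertex of a layer contributes at least its density. So a Chernoff bound fails
  for \<open>A\<close> with probability at most \<open>n\<close> to the power \<open>- 2 card A\<close>, which absorbs the number of sets
  \<open>A\<close> of each size. The random choice is derandomised through the multilinearity of the exponential
  moments.
\<close>

section \<open>Derandomisation and exponential moments\<close>

text \<open>Method of conditional expectations: the right side is the mean of the left when each
  \<open>e\<close> joins \<open>X\<close> independently with probability \<open>p e\<close>.
  Deciding one element at a time, some decision does not increase the mean. The factor already
  decided is absorbed into \<open>c\<close>, hence the induction over arbitrary
  \<open>c\<close>.\<close>

lemma multiaffine_choice:
  fixes c :: "'j \<Rightarrow> real" and u v :: "'j \<Rightarrow> 'e \<Rightarrow> real" and p :: "'e \<Rightarrow> real"
  assumes "finite E" and "\<And>e. e \<in> E \<Longrightarrow> 0 \<le> p e \<and> p e \<le> 1"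
  shows "\<exists>X\<subseteq>E. (\<Sum>j\<in>J. c j * (\<Prod>e\<in>E. if e \<in> X then u j e else v j e))
           \<le> (\<Sum>j\<in>J. c j * (\<Prod>e\<in>E. p e * u j e + (1 - p e) * v j e))"
  using assms
proof (induction E arbitrary: c rule: finite_induct)
  case empty
  then show ?case by simp
next
  case (insert x E)
  let ?P = "\<lambda>j. \<Prod>e\<in>E. p e * u j e + (1 - p e) * v j e"
  let ?Q = "\<lambda>X j. \<Prod>e\<in>E. if e \<in> X then u j e else v j e"
  have px: "0 \<le> p x" "p x \<le> 1" and pE: "\<And>e. e \<in> E \<Longrightarrow> 0 \<le> p e \<and> p e \<le> 1"
    using insert.prems by auto
  define A where "A = (\<Sum>j\<in>J. c j * u j x * ?P j)"
  define B where "B = (\<Sum>j\<in>J. c j * v j x * ?P j)"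
  have "(\<Sum>j\<in>J. c j * (\<Prod>e\<in>insert x E. p e * u j e + (1 - p e) * v j e)) = p x * A + (1 - p x) * B"
    using insert.hyps unfolding A_def B_def sum_distrib_left sum.distrib[symmetric]
    by (intro sum.cong) (auto simp: algebra_simps)
  moreover have "min A B \<le> p x * A + (1 - p x) * B"
    using convex_bound_le[of "- A" "- min A B" "- B" "p x" "1 - p x"] px by auto
  ultimately consider
    "A \<le> (\<Sum>j\<in>J. c j * (\<Prod>e\<in>insert x E. p e * u j e + (1 - p e) * v j e))" |
    "B \<le> (\<Sum>j\<in>J. c j * (\<Prod>e\<in>insert x E. p e * u j e + (1 - p e) * v j e))"
    by linarith
  then show ?case
  proof cases
    case 1
    obtain X where X: "X \<subseteq> E" "(\<Sum>j\<in>J. c j * u j x * ?Q X j) \<le> A"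
      using insert.IH[OF pE, of "\<lambda>j. c j * u j x"] unfolding A_def by auto
    have "?Q (insert x X) j = ?Q X j" for j
      using insert.hyps by (intro prod.cong) auto
    then have "(\<Sum>j\<in>J. c j * (\<Prod>e\<in>insert x E. if e \<in> insert x X then u j e else v j e)) \<le> A"
      using X insert.hyps by (simp add: mult.assoc)
    then show ?thesis using 1 X(1) by (intro exI[of _ "insert x X"]) auto
  next
    case 2
    obtain X where X: "X \<subseteq> E" "(\<Sum>j\<in>J. c j * v j x * ?Q X j) \<le> B"
      using insert.IH[OF pE, of "\<lambda>j. c j * v j x"] unfolding B_def by auto
    have "x \<notin> X" using X(1) insert.hyps by auto
    then have "(\<Sum>j\<in>J. c j * (\<Prod>e\<in>insert x E. if e \<in> X then u j e else v j e)) \<le> B"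
      using X insert.hyps by (simp add: mult.assoc)
    then show ?thesis using 2 X(1) by (intro exI[of _ X]) auto
  qed
qed

text \<open>The left side is the exponential moment of a variable with value \<open>a / p\<close>
  with probability \<open>p\<close> and 0 otherwise, so with mean \<open>a\<close>. It follows from
  \<open>exp x \<le> 1 + x + x\<^sup>2\<close>. Keeping \<open>b\<close> instead of bounding it by 1
  makes the quadratic loss a small multiple of the mean.\<close>

lemma bernoulli_mgf_le:
  fixes a p s b :: real
  assumes "0 < p" "p \<le> 1" "0 \<le> a" "\<bar>s\<bar> * (a / p) \<le> b" "b \<le> 1"
  shows "p * exp (s * (a / p)) + (1 - p) \<le> exp (s * a + \<bar>s\<bar> * a * b)"
proof -
  define x where "x = s * (a / p)"
  have ax: "\<bar>x\<bar> = \<bar>s\<bar> * (a / p)" using assms by (simp add: x_def abs_mult)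
  have "exp x \<le> 1 + x + x\<^sup>2"
  proof (cases "x \<ge> 0")
    case True
    then show ?thesis using exp_bound[of x] ax assms by linarith
  next
    case False
    \<comment> \<open>For negative \<open>x\<close> the bound is proved through the reciprocal:
      \<open>1 + x + x\<^sup>2\<close> times this lower bound for \<open>exp (- x)\<close> is at
      least 1.\<close>
    have "exp (- x) \<ge> 1 + (- x) + (- x)\<^sup>2 / 2"
      using exp_lower_Taylor_quadratic[of "- x"] False by auto
    moreover have "(1 + x + x\<^sup>2) * (1 + (- x) + (- x)\<^sup>2 / 2) \<ge> 1"
    proof -
      have "(1 + x + x\<^sup>2) * (1 + (- x) + (- x)\<^sup>2 / 2) = 1 + x\<^sup>2 / 2 * (1 - x + x\<^sup>2)"
        by (simp add: power2_eq_square field_simps)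
      moreover have "0 \<le> x\<^sup>2 / 2 * (1 - x + x\<^sup>2)"
        using False by (intro mult_nonneg_nonneg) (auto intro: add_nonneg_nonneg)
      ultimately show ?thesis by linarith
    qed
    moreover have "0 \<le> 1 + x + x\<^sup>2" using ax assms by (simp add: abs_if split: if_splits)
    ultimately have "1 \<le> (1 + x + x\<^sup>2) * exp (- x)"
      by (meson mult_left_mono order_trans)
    then show ?thesis by (simp add: exp_minus field_simps)
  qed
  then have "p * exp x + (1 - p) \<le> 1 + p * (x + x\<^sup>2)"
    using assms mult_left_mono[of "exp x" "1 + x + x\<^sup>2" p] by (simp add: algebra_simps)
  also have "\<dots> \<le> exp (p * (x + x\<^sup>2))" by (rule exp_ge_add_one_self)
  also have "\<dots> \<le> exp (s * a + \<bar>s\<bar> * a * b)"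
  proof -
    have "x\<^sup>2 = \<bar>x\<bar> * \<bar>x\<bar>" by (simp add: power2_eq_square)
    also have "\<dots> \<le> \<bar>x\<bar> * b" using ax assms by (intro mult_left_mono) auto
    finally have "p * (x + x\<^sup>2) \<le> p * x + p * (\<bar>x\<bar> * b)"
      using assms mult_left_mono[of "x\<^sup>2" "\<bar>x\<bar> * b" p] by (simp add: algebra_simps)
    also have "\<dots> = s * a + \<bar>s\<bar> * a * b" using assms unfolding ax by (simp add: x_def)
    finally show ?thesis by simp
  qed
  finally show ?thesis by (simp add: x_def)
qed

section \<open>Summation by parts, density chains and submodularity\<close>

text \<open>Abel summation: the weighted sum combines the tail sums with coefficients
  \<open>w i - w (i - 1)\<close>, and \<open>w 0\<close> at the start, all nonnegative. A tail with
  \<open>w i = 0\<close> has coefficient 0, so only tails at positive weights matter.\<close>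

lemma weighted_tail_sum_nonneg:
  fixes w z :: "nat \<Rightarrow> real"
  assumes tail: "\<And>i. i < L \<Longrightarrow> 0 < w i \<Longrightarrow> 0 \<le> (\<Sum>l=i..<L. z l)"
    and mono: "\<And>i. Suc i < L \<Longrightarrow> w i \<le> w (Suc i)"
    and nonneg: "\<And>i. i < L \<Longrightarrow> 0 \<le> w i"
  shows "0 \<le> (\<Sum>l<L. w l * z l)"
proof -
  \<comment> \<open>Downward induction on \<open>i\<close>; \<open>c\<close> plays the part of the
    preceding, smaller weight.\<close>
  have "\<forall>c. 0 \<le> c \<and> (i < L \<longrightarrow> c \<le> w i) \<longrightarrow> c * (\<Sum>l=i..<L. z l) \<le> (\<Sum>l=i..<L. w l * z l)"
    if "i \<le> L" for i
    using that
  proof (induction rule: inc_induct)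
    case base
    then show ?case by simp
  next
    case (step i)
    have split: "(\<Sum>l=i..<L. h l) = h i + (\<Sum>l=Suc i..<L. h l)" for h :: "nat \<Rightarrow> real"
      using step.hyps by (simp add: sum.atLeast_Suc_lessThan)
    have *: "w i * (\<Sum>l=i..<L. z l) \<le> (\<Sum>l=i..<L. w l * z l)"
      using step.IH[rule_format, of "w i"] nonneg[of i] mono[of i] step.hyps
      by (simp add: split algebra_simps)
    show ?case
    proof (intro allI impI)
      fix c assume c: "0 \<le> c \<and> (i < L \<longrightarrow> c \<le> w i)"
      have "c * (\<Sum>l=i..<L. z l) \<le> w i * (\<Sum>l=i..<L. z l)"
      proof (cases "w i = 0")
        case True
        then have "c = 0" using c step.hyps by simp
        then show ?thesis using True by simp
      next
        case False
        then show ?thesis using c step.hyps nonneg[of i] tail[of i]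
          by (intro mult_right_mono) auto
      qed
      then show "c * (\<Sum>l=i..<L. z l) \<le> (\<Sum>l=i..<L. w l * z l)" using * by linarith
    qed
  qed
  from this[of 0, rule_format, of 0] show ?thesis
    using nonneg[of 0] by (auto simp: atLeast0LessThan)
qed

text \<open>Greedy recursion: a proper superset \<open>P\<close> of \<open>T0\<close> with least
  density is the next member, and the chain built from \<open>P\<close> supplies the rest.\<close>

lemma min_density_chain:
  fixes f :: "'v set \<Rightarrow> real"
  assumes fin: "finite V" and "T0 \<subseteq> V"
  shows "\<exists>L T (d :: nat \<Rightarrow> real). T 0 = T0 \<and> T L = V \<and> (\<forall>i<L. T i \<subset> T (Suc i) \<and> T (Suc i) \<subseteq> V \<and>
     f (T (Suc i)) - f (T i) = d i * card (T (Suc i) - T i) \<and>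
     (\<forall>R. T i \<subseteq> R \<and> R \<subseteq> V \<longrightarrow> d i * card (R - T i) \<le> f R - f (T i)))"
  using assms(2)
proof (induction "card (V - T0)" arbitrary: T0 rule: less_induct)
  case less
  show ?case
  proof (cases "T0 = V")
    case True
    then show ?thesis by (intro exI[of _ 0] exI[of _ "\<lambda>_. V"]) auto
  next
    case False
    define \<R> where "\<R> = {R. T0 \<subset> R \<and> R \<subseteq> V}"
    define dens where "dens R = (f R - f T0) / card (R - T0)" for R
    have "finite \<R>" unfolding \<R>_def by (rule finite_subset[of _ "Pow V"]) (use fin in auto)
    moreover have "V \<in> \<R>" using False less.prems unfolding \<R>_def by auto
    ultimately obtain P where P: "P \<in> \<R>" "\<And>R. R \<in> \<R> \<Longrightarrow> dens P \<le> dens R"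
      using arg_min_if_finite[of \<R> dens] by (metis empty_iff leI)
    have cpos: "0 < card (R - T0)" if "R \<in> \<R>" for R
      using that fin unfolding \<R>_def card_gt_0_iff by (auto intro: finite_subset)
    have sub: "T0 \<subset> P" "P \<subseteq> V" using P unfolding \<R>_def by auto
    then have "card (V - P) < card (V - T0)" using fin by (intro psubset_card_mono) auto
    from less.hyps[OF this sub(2)] obtain L T and d :: "nat \<Rightarrow> real" where
      IH: "T 0 = P" "T L = V" "\<forall>i<L. T i \<subset> T (Suc i) \<and> T (Suc i) \<subseteq> V \<and>
       f (T (Suc i)) - f (T i) = d i * card (T (Suc i) - T i) \<and>
       (\<forall>R. T i \<subseteq> R \<and> R \<subseteq> V \<longrightarrow> d i * card (R - T i) \<le> f R - f (T i))"
      by (elim exE conjE) (rule that)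
    have e: "f P - f T0 = dens P * card (P - T0)"
      using cpos[OF P(1)] unfolding dens_def by simp
    have r: "dens P * card (R - T0) \<le> f R - f T0" if "T0 \<subseteq> R" "R \<subseteq> V" for R
    proof (cases "R = T0")
      case True then show ?thesis by simp
    next
      case False
      then have R: "R \<in> \<R>" using that unfolding \<R>_def by auto
      show ?thesis using P(2)[OF R] cpos[OF R] unfolding dens_def[of R] by (simp add: pos_le_divide_eq)
    qed
    show ?thesis
    proof (intro exI[of _ "Suc L"] exI[of _ "case_nat T0 T"] exI[of _ "case_nat (dens P) d"] conjI allI impI)
      fix i assume i: "i < Suc L"
      let ?T = "case_nat T0 T" and ?d = "case_nat (dens P) d"
      show "?T i \<subset> ?T (Suc i)" "?T (Suc i) \<subseteq> V"
        "f (?T (Suc i)) - f (?T i) = ?d i * card (?T (Suc i) - ?T i)"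
        using i IH e sub by (cases i; simp)+
      show "?d i * card (R - ?T i) \<le> f R - f (?T i)" if "?T i \<subseteq> R \<and> R \<subseteq> V" for R
        using i IH(3) r that by (cases i) simp_all
    qed (use IH in simp_all)
  qed
qed

text \<open>Diminishing returns, applied while the elements of \<open>B - A\<close> are added one by
  one to both \<open>A\<close> and \<open>A \<inter> B\<close>.\<close>

lemma submodular_on_lattice:
  assumes "submodular_on U g" "finite U" "A \<subseteq> U" "B \<subseteq> U"
  shows "g (A \<union> B) + g (A \<inter> B) \<le> g A + g B"
proof -
  have "g (A \<union> D) - g A \<le> g ((A \<inter> B) \<union> D) - g (A \<inter> B)" if "finite D" "D \<subseteq> B - A" for D
    using that
  proof (induction D rule: finite_induct)
    case empty then show ?case by simp
  next
    case (insert x D)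
    have "g ((A \<union> D) \<union> {x}) - g (A \<union> D) \<le> g ((A \<inter> B \<union> D) \<union> {x}) - g (A \<inter> B \<union> D)"
      using assms(1)[unfolded submodular_on_def, rule_format, of "A \<inter> B \<union> D" "A \<union> D" x]
        insert.hyps insert.prems assms by auto
    then show ?case using insert by auto
  qed
  from this[of "B - A"] assms have "g (A \<union> (B - A)) - g A \<le> g (A \<inter> B \<union> (B - A)) - g (A \<inter> B)"
    by (auto intro: finite_subset)
  moreover have "A \<inter> B \<union> (B - A) = B" by auto
  ultimately show ?thesis by simp
qed

lemma sum_Pow_power_card:
  fixes z :: real
  assumes "finite V"
  shows "(\<Sum>A\<in>Pow V. z ^ card A) = (1 + z) ^ card V"
  using prod_add[OF assms, of "\<lambda>_. z" "\<lambda>_. 1"] assms by (simp add: add.commute)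

section \<open>Importance sampling with a Chernoff bound\<close>

text \<open>Each \<open>e\<close> is kept with probability \<open>min 1 (q e)\<close> and reweighted
  to preserve means. By \<open>a_le\<close> every reweighted sampled term is at most
  \<open>1 / K\<close>, which gives the exponents in \<open>small\<close>: a union bound over both
  directions of deviation for each \<open>j\<close>, plus the event of keeping too many
  elements.\<close>

lemma importance_sampling:
  fixes a :: "'j \<Rightarrow> 'e \<Rightarrow> real" and q :: "'e \<Rightarrow> real" and M :: real
  assumes fin: "finite E" "finite J" and eps: "0 < \<epsilon>" "\<epsilon> < 1" and K: "0 < K"
    and a_nonneg: "\<And>j e. j \<in> J \<Longrightarrow> e \<in> E \<Longrightarrow> 0 \<le> a j e"
    and a_le: "\<And>j e. j \<in> J \<Longrightarrow> e \<in> E \<Longrightarrow> K * a j e \<le> q e"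
    and q_nonneg: "\<And>e. e \<in> E \<Longrightarrow> 0 \<le> q e"
    and M: "sum q E \<le> M"
    and small: "(\<Sum>j\<in>J. 2 * exp (- (\<epsilon>\<^sup>2 * K * sum (a j) E / 4))) + exp (- M) < 1"
  shows "\<exists>r. (\<forall>e. 0 \<le> r e) \<and> card {e\<in>E. r e \<noteq> 0} \<le> 4 * M \<and>
    (\<forall>j\<in>J. \<bar>(\<Sum>e\<in>E. r e * a j e) - sum (a j) E\<bar> \<le> \<epsilon> * sum (a j) E)"
proof -
  define E1 where "E1 = {e\<in>E. 1 \<le> q e}"
  define E2 where "E2 = {e\<in>E. 0 < q e \<and> q e < 1}"
  \<comment> \<open>With terms at most \<open>1 / K\<close>, this rate keeps exponents below
    \<open>\<epsilon> / 2\<close>. The quadratic loss then uses at most half of the allowance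
    \<open>t * \<epsilon> * F j\<close>.\<close>
  define t where "t = \<epsilon> * K / 2"
  define \<mu> where "\<mu> j = sum (a j) E2" for j
  define F where "F j = sum (a j) E" for j
  define S where "S = J \<times> {1, - 1 :: real}"
  \<comment> \<open>Pessimistic estimators: \<open>Some (j, s)\<close> controls the deviation of the \<open>j\<close>-th sum in direction
    \<open>s\<close>, \<open>None\<close> the number of sampled elements.\<close>
  define c where "c = case_option (exp (- 3 * M)) (\<lambda>(j, s). exp (- (s * t * \<mu> j + t * \<epsilon> * F j)))"
  define u where "u = case_option (\<lambda>_. exp 1) (\<lambda>(j, s) e. exp (s * t * (a j e / q e)))"
  have t: "0 < t" using eps K by (simp add: t_def)
  have fE: "finite E1" "finite E2" "E1 \<subseteq> E" "E2 \<subseteq> E" "E1 \<inter> E2 = {}" and fS: "finite S"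
    using fin unfolding E1_def E2_def S_def by auto
  have sumsplit: "(\<Sum>e\<in>E. h e) = sum h E1 + sum h E2" if "\<And>e. e \<in> E \<Longrightarrow> q e = 0 \<Longrightarrow> h e = 0"
    for h :: "'e \<Rightarrow> real"
  proof -
    have "sum h E = sum h (E1 \<union> E2)"
      by (rule sum.mono_neutral_right) (use fin that q_nonneg in \<open>force simp: E1_def E2_def\<close>)+
    then show ?thesis using fE by (simp add: sum.union_disjoint)
  qed
  have a0: "a j e = 0" if "j \<in> J" "e \<in> E" "q e = 0" for j e
    using a_nonneg[OF that(1,2)] a_le[OF that(1,2)] that(3) K
    by (metis antisym mult_le_0_iff not_le)
  have F_split: "F j = sum (a j) E1 + \<mu> j" if "j \<in> J" for j
    unfolding F_def \<mu>_def by (rule sumsplit) (use a0 that in auto)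
  have \<mu>_le: "0 \<le> \<mu> j" "\<mu> j \<le> F j" if "j \<in> J" for j
    using that fE a_nonneg F_split[OF that] unfolding \<mu>_def
    by (auto intro!: sum_nonneg)
  have qM: "sum q E1 \<le> M" "sum q E2 \<le> M"
  proof -
    have "sum q E = sum q E1 + sum q E2" by (rule sumsplit)
    moreover have "0 \<le> sum q E1" "0 \<le> sum q E2" using fE q_nonneg by (auto intro!: sum_nonneg)
    ultimately show "sum q E1 \<le> M" "sum q E2 \<le> M" using M by linarith+
  qed
  let ?R = "\<lambda>i. c i * (\<Prod>e\<in>E2. q e * u i e + (1 - q e) * 1)"
  \<comment> \<open>The mean of \<open>exp (card X)\<close> is at most \<open>exp (2 * M)\<close>,
    since \<open>exp 1 \<le> 3\<close>; the threshold \<open>3 * M\<close> leaves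
    \<open>exp (- M)\<close>.\<close>
  have RN: "?R None \<le> exp (- M)"
  proof -
    have "(\<Prod>e\<in>E2. q e * u None e + (1 - q e) * 1) \<le> (\<Prod>e\<in>E2. exp (2 * q e))"
    proof (rule prod_mono, intro conjI)
      fix e assume "e \<in> E2"
      then have q: "0 < q e" "q e < 1" unfolding E2_def by auto
      then show "0 \<le> q e * u None e + (1 - q e) * 1" by (simp add: u_def)
      have "q e * exp 1 \<le> q e * 3" using q exp_le by (intro mult_left_mono) auto
      then have "q e * u None e + (1 - q e) * 1 \<le> 1 + 2 * q e" by (simp add: u_def)
      then show "q e * u None e + (1 - q e) * 1 \<le> exp (2 * q e)"
        using exp_ge_add_one_self[of "2 * q e"] by linarith
    qed
    also have "\<dots> = exp (2 * sum q E2)" using fE by (simp add: exp_sum sum_distrib_left)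
    also have "\<dots> \<le> exp (2 * M)" using qM by simp
    finally have "?R None \<le> c None * exp (2 * M)" by (intro mult_left_mono) (auto simp: c_def)
    then show ?thesis by (simp add: c_def flip: exp_add)
  qed
  have RS: "?R (Some (j, s)) \<le> exp (- (\<epsilon>\<^sup>2 * K * F j / 4))" if "j \<in> J" "s \<in> {1, -1}" for j s
  proof -
    have "(\<Prod>e\<in>E2. q e * u (Some (j, s)) e + (1 - q e) * 1)
        \<le> (\<Prod>e\<in>E2. exp (s * t * a j e + t * a j e * (\<epsilon> / 2)))"
    proof (rule prod_mono, intro conjI)
      fix e assume "e \<in> E2"
      then have q: "0 < q e" "q e < 1" and e: "e \<in> E" unfolding E2_def by auto
      then show "0 \<le> q e * u (Some (j, s)) e + (1 - q e) * 1" by (simp add: u_def)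
      have st: "\<bar>s * t\<bar> = t" using that t by auto
      have "t * (a j e / q e) \<le> \<epsilon> / 2"
        using a_le[OF that(1) e] q eps mult_left_mono[of "K * a j e" "q e" "\<epsilon> / 2"]
        by (simp add: t_def field_simps)
      then show "q e * u (Some (j, s)) e + (1 - q e) * 1 \<le> exp (s * t * a j e + t * a j e * (\<epsilon> / 2))"
        using bernoulli_mgf_le[of "q e" "a j e" "s * t" "\<epsilon> / 2"] q a_nonneg[OF that(1) e] eps
        unfolding st by (simp add: u_def)
    qed
    also have "\<dots> = exp (s * t * \<mu> j + t * \<mu> j * (\<epsilon> / 2))"
      using fE by (simp add: exp_sum[symmetric] sum.distrib \<mu>_def sum_distrib_left sum_distrib_right)
    finally have "?R (Some (j, s)) \<le> c (Some (j, s)) * exp (s * t * \<mu> j + t * \<mu> j * (\<epsilon> / 2))"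
      by (intro mult_left_mono) (auto simp: c_def)
    also have "\<dots> = exp (t * \<mu> j * (\<epsilon> / 2) - t * \<epsilon> * F j)" by (simp add: c_def flip: exp_add)
    also have "\<dots> \<le> exp (- (\<epsilon>\<^sup>2 * K * F j / 4))"
    proof -
      have "t * \<mu> j * (\<epsilon> / 2) \<le> t * F j * (\<epsilon> / 2)"
        using \<mu>_le[OF that(1)] t eps by (intro mult_right_mono mult_left_mono) auto
      moreover have "t * F j * (\<epsilon> / 2) - t * \<epsilon> * F j = - (\<epsilon>\<^sup>2 * K * F j / 4)"
        by (simp add: t_def power2_eq_square field_simps)
      ultimately show ?thesis by (subst exp_le_cancel_iff) linarith
    qed
    finally show ?thesis .
  qed
  let ?I = "insert None (Some ` S)"
  have Isum: "(\<Sum>i\<in>?I. ?R i) = ?R None + (\<Sum>x\<in>S. ?R (Some x))"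
    using fS by (subst sum.insert) (auto simp: sum.reindex)
  have "(\<Sum>x\<in>S. ?R (Some x)) \<le> (\<Sum>(j, s)\<in>S. exp (- (\<epsilon>\<^sup>2 * K * F j / 4)))"
    by (rule sum_mono) (use RS in \<open>auto simp: S_def\<close>)
  also have "\<dots> = (\<Sum>j\<in>J. 2 * exp (- (\<epsilon>\<^sup>2 * K * F j / 4)))"
    using fin unfolding S_def by (simp add: sum.cartesian_product[symmetric])
  finally have total: "(\<Sum>i\<in>?I. ?R i) < 1" using RN small Isum unfolding F_def by linarith
  have "\<And>e. e \<in> E2 \<Longrightarrow> 0 \<le> q e \<and> q e \<le> 1" unfolding E2_def by auto
  then have "\<exists>X\<subseteq>E2. (\<Sum>i\<in>?I. c i * (\<Prod>e\<in>E2. if e \<in> X then u i e else 1)) \<le> (\<Sum>i\<in>?I. ?R i)"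
    by (intro multiaffine_choice fE)
  then obtain X where X: "X \<subseteq> E2"
    "(\<Sum>i\<in>?I. c i * (\<Prod>e\<in>E2. if e \<in> X then u i e else 1)) \<le> (\<Sum>i\<in>?I. ?R i)"
    by (elim exE conjE) (rule that)
  have fX: "finite X" using X fE finite_subset by blast
  have "(\<Prod>e\<in>E2. if e \<in> X then u i e else 1) = (\<Prod>e\<in>X. u i e)" for i
    using X(1) fE by (simp add: prod.If_cases Int_absorb1)
  with X(2) total have lt: "(\<Sum>i\<in>?I. c i * (\<Prod>e\<in>X. u i e)) < 1" by simp
  \<comment> \<open>All estimators are nonnegative with sum below 1, so none reaches 1; taking
    logarithms then excludes every bad event for this \<open>X\<close>.\<close>
  have each: "c i * (\<Prod>e\<in>X. u i e) < 1" if "i \<in> ?I" for i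
  proof -
    have "c i * (\<Prod>e\<in>X. u i e) \<le> (\<Sum>i\<in>?I. c i * (\<Prod>e\<in>X. u i e))"
      by (rule member_le_sum[OF that])
        (use fS in \<open>auto simp: c_def u_def intro!: mult_nonneg_nonneg prod_nonneg split: option.splits\<close>)
    then show ?thesis using lt by linarith
  qed
  define r where "r e = (if e \<in> E1 then 1 else if e \<in> X then 1 / q e else 0)" for e
  have "card X \<le> 3 * M"
    using each[of None] by (simp add: c_def u_def flip: exp_of_nat_mult exp_add)
  moreover have "card E1 \<le> M"
  proof -
    have "real (card E1) = (\<Sum>e\<in>E1. 1)" by simp
    also have "\<dots> \<le> sum q E1" by (rule sum_mono) (auto simp: E1_def)
    finally show ?thesis using qM by linarith
  qed
  moreover have "card {e\<in>E. r e \<noteq> 0} \<le> card (E1 \<union> X)"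
    by (rule card_mono) (use fE fX in \<open>auto simp: r_def\<close>)
  ultimately have "card {e\<in>E. r e \<noteq> 0} \<le> 4 * M"
    using card_Un_le[of E1 X] by linarith
  moreover have "\<forall>e. 0 \<le> r e"
    using X(1) by (auto simp: r_def E2_def)
  moreover have "\<bar>(\<Sum>e\<in>E. r e * a j e) - sum (a j) E\<bar> \<le> \<epsilon> * sum (a j) E" if j: "j \<in> J" for j
  proof -
    define Y where "Y = (\<Sum>e\<in>X. a j e / q e)"
    have "(\<Sum>e\<in>E. r e * a j e) = (\<Sum>e\<in>E1. r e * a j e) + (\<Sum>e\<in>E2. r e * a j e)"
      by (rule sumsplit) (use a0 j in auto)
    also have "(\<Sum>e\<in>E1. r e * a j e) = sum (a j) E1" by (intro sum.cong) (auto simp: r_def)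
    also have "(\<Sum>e\<in>E2. r e * a j e) = (\<Sum>e\<in>E2. if e \<in> X then a j e / q e else 0)"
      using fE by (intro sum.cong) (auto simp: r_def)
    also have "\<dots> = Y" using X(1) fE by (simp add: Y_def sum.If_cases Int_absorb1)
    finally have diff: "(\<Sum>e\<in>E. r e * a j e) - sum (a j) E = Y - \<mu> j"
      using F_split[OF j] unfolding F_def by simp
    have "s * (Y - \<mu> j) < \<epsilon> * F j" if s: "s \<in> {1, -1}" for s
    proof -
      have "exp (- (s * t * \<mu> j + t * \<epsilon> * F j)) * exp (s * t * Y) < 1"
        using each[of "Some (j, s)"] s j fX
        by (simp add: S_def c_def u_def Y_def exp_sum sum_distrib_left)
      then have "t * (s * (Y - \<mu> j)) < t * (\<epsilon> * F j)"
        by (simp add: algebra_simps flip: exp_add)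
      then show ?thesis using t by simp
    qed
    from this[of 1] this[of "-1"] show ?thesis unfolding diff F_def by (simp add: abs_le_iff)
  qed
  ultimately show ?thesis by blast
qed

section \<open>Sparsifying sums of monotone submodular functions\<close>

theorem monotone_submodular_sum_sparsifier:
  fixes G :: "'e \<Rightarrow> 'v set \<Rightarrow> real"
  assumes fin: "finite V" "finite E" and V: "V \<noteq> {}" and eps: "0 < \<epsilon>" "\<epsilon> < 1"
    and G_empty: "\<And>e. e \<in> E \<Longrightarrow> 0 \<le> G e {}"
    and G_mono: "\<And>e A B. e \<in> E \<Longrightarrow> A \<subseteq> B \<Longrightarrow> B \<subseteq> V \<Longrightarrow> G e A \<le> G e B"
    and G_submod: "\<And>e A B. e \<in> E \<Longrightarrow> A \<subseteq> V \<Longrightarrow> B \<subseteq> V \<Longrightarrow>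
      G e (A \<union> B) + G e (A \<inter> B) \<le> G e A + G e B"
  shows "\<exists>r. (\<forall>e. 0 \<le> r e) \<and>
    card {e\<in>E. r e \<noteq> 0} \<le> 16 / \<epsilon>\<^sup>2 * ln (16 * (card V)\<^sup>2) * (card V + 1) \<and>
    (\<forall>S\<subseteq>V. \<bar>(\<Sum>e\<in>E. r e * G e S) - (\<Sum>e\<in>E. G e S)\<bar> \<le> \<epsilon> * (\<Sum>e\<in>E. G e S))"
proof -
  define f where "f S = (\<Sum>e\<in>E. G e S)" for S
  define n where "n = card V"
  have n: "1 \<le> n" using fin V by (simp add: n_def card_gt_0_iff Suc_leI)
  have f_mono: "f A \<le> f B" if "A \<subseteq> B" "B \<subseteq> V" for A B
    unfolding f_def by (rule sum_mono) (use G_mono that in auto)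
  have f_submod: "f (A \<union> B) + f (A \<inter> B) \<le> f A + f B" if "A \<subseteq> V" "B \<subseteq> V" for A B
    unfolding f_def sum.distrib[symmetric] by (rule sum_mono) (use G_submod that in auto)
  have f_empty: "0 \<le> f {}" unfolding f_def by (rule sum_nonneg) (use G_empty in auto)

  obtain L T and d :: "nat \<Rightarrow> real" where T0: "T 0 = {}" and TL: "T L = V" and
    chain: "\<forall>i<L. T i \<subset> T (Suc i) \<and> T (Suc i) \<subseteq> V \<and>
      f (T (Suc i)) - f (T i) = d i * card (T (Suc i) - T i) \<and>
      (\<forall>R. T i \<subseteq> R \<and> R \<subseteq> V \<longrightarrow> d i * card (R - T i) \<le> f R - f (T i))"
    using min_density_chain[OF fin(1) empty_subsetI, of f] by (elim exE conjE) (rule that)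
  have strict: "T i \<subset> T (Suc i)" and TSV: "T (Suc i) \<subseteq> V"
    and slope: "f (T (Suc i)) - f (T i) = d i * card (T (Suc i) - T i)" if "i < L" for i
    using chain that by simp_all
  have dens: "d i * card (R - T i) \<le> f R - f (T i)" if "i < L" "T i \<subseteq> R" "R \<subseteq> V" for i R
    using chain that by simp
  have TV: "T i \<subseteq> V" if "i \<le> L" for i
    using that T0 TSV by (cases i) auto
  have fT: "finite (T i)" if "i \<le> L" for i using TV[OF that] fin(1) by (rule finite_subset)
  have T_mono: "T i \<subseteq> T j" if "i \<le> j" "j \<le> L" for i j
    using that
  proof (induction j rule: dec_induct)
    case (step m)
    then show ?case using strict[of m] by auto
  qed simp
  have card_pos: "0 < card (T (Suc i) - T i)" if "i < L" for i
    using strict[OF that] fT[of "Suc i"] that by (auto simp: card_gt_0_iff)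
  have d_nonneg: "0 \<le> d i" if "i < L" for i
    using slope[OF that] card_pos[OF that] f_mono[of "T i" "T (Suc i)"] strict[OF that] TSV[OF that]
    by (metis diff_ge_0_iff_ge of_nat_0_less_iff psubset_imp_subset zero_le_mult_iff not_le)
  have card_telescope: "(\<Sum>l<m. card (T (Suc l) - T l)) = card (T m)" if "m \<le> L" for m
    using that
  proof (induction m)
    case 0 then show ?case using T0 by simp
  next
    case (Suc m)
    then have "card (T (Suc m) - T m) + card (T m) = card (T (Suc m))"
      using strict[of m] fT[of "Suc m"] fT[of m] card_mono[of "T (Suc m)" "T m"]
      by (simp add: card_Diff_subset)
    then show ?case using Suc by simp
  qed
  have Ln: "L \<le> n"
  proof -
    have "L = (\<Sum>l<L. 1)" by simp
    also have "\<dots> \<le> (\<Sum>l<L. card (T (Suc l) - T l))"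
      by (rule sum_mono) (use card_pos in \<open>auto simp: Suc_le_eq\<close>)
    finally show ?thesis using card_telescope[of L] TL by (simp add: n_def)
  qed
  \<comment> \<open>The density from \<open>T i\<close> to \<open>T (Suc (Suc i))\<close> is a
    weighted average of \<open>d i\<close> and \<open>d (Suc i)\<close>, and by minimality it is at
    least \<open>d i\<close>.\<close>
  have d_mono: "d i \<le> d (Suc i)" if "Suc i < L" for i
  proof -
    let ?A = "T i" let ?B = "T (Suc i)" let ?C = "T (Suc (Suc i))"
    have AB: "?A \<subset> ?B" and BC: "?B \<subset> ?C" and C: "?C \<subseteq> V" using strict TSV that by auto
    have fin': "finite ?B" "finite ?C" using fT that by auto
    have "?C - ?A = (?C - ?B) \<union> (?B - ?A)" using AB BC by auto
    then have "card (?C - ?A) = card (?C - ?B) + card (?B - ?A)"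
      using fin' by (simp only:) (intro card_Un_disjoint, auto)
    then have "d i * card (?C - ?B) + d i * card (?B - ?A) \<le> f ?C - f ?A"
      using dens[of i ?C] AB BC C that by (simp add: distrib_left)
    then have "d i * card (?C - ?B) \<le> d (Suc i) * card (?C - ?B)"
      using slope[of i] slope[of "Suc i"] that by simp
    then show ?thesis using card_pos[of "Suc i"] that by simp
  qed

  \<comment> \<open>The mutual information of \<open>S\<close> and \<open>T (Suc l)\<close> given \<open>T l\<close>.\<close>
  define I where "I e l S = (G e (S \<union> T l) - G e (T l)) - (G e (S \<union> T (Suc l)) - G e (T (Suc l)))"
    for e l S
  have I_nonneg: "0 \<le> I e l S" and I_le: "I e l S \<le> G e (T (Suc l)) - G e (T l)"
    if "e \<in> E" "l < L" "S \<subseteq> V" for e l S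
  proof -
    have s: "T l \<subseteq> T (Suc l)" "T (Suc l) \<subseteq> V" using strict TSV that by auto
    have "(S \<union> T l) \<union> T (Suc l) = S \<union> T (Suc l)" using s by auto
    with G_submod[OF that(1), of "S \<union> T l" "T (Suc l)"] s that
    have "G e (S \<union> T (Suc l)) + G e ((S \<union> T l) \<inter> T (Suc l)) \<le> G e (S \<union> T l) + G e (T (Suc l))"
      by auto
    moreover have "G e (T l) \<le> G e ((S \<union> T l) \<inter> T (Suc l))" using s that by (intro G_mono) auto
    ultimately show "0 \<le> I e l S" unfolding I_def by linarith
    have "G e (S \<union> T l) \<le> G e (S \<union> T (Suc l))" using s that by (intro G_mono) auto
    then show "I e l S \<le> G e (T (Suc l)) - G e (T l)" unfolding I_def by linarith
  qed
  \<comment> \<open>Submodularity bounds the layer below by the growth of \<open>f\<close> from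
    \<open>T l\<close> to \<open>(S \<union> T l) \<inter> T (Suc l)\<close>, and minimality of
    \<open>d l\<close> bounds that growth.\<close>
  have I_sum: "d l * card (S \<inter> (T (Suc l) - T l)) \<le> (\<Sum>e\<in>E. I e l S)" if "l < L" "S \<subseteq> V" for l S
  proof -
    have s: "T l \<subseteq> T (Suc l)" "T (Suc l) \<subseteq> V" using strict TSV that by auto
    have eq: "(S \<union> T l) \<union> T (Suc l) = S \<union> T (Suc l)"
      "(S \<union> T l) \<inter> T (Suc l) - T l = S \<inter> (T (Suc l) - T l)" using s by auto
    have "d l * card ((S \<union> T l) \<inter> T (Suc l) - T l) \<le> f ((S \<union> T l) \<inter> T (Suc l)) - f (T l)"
      using s that by (intro dens) auto
    moreover have "f (S \<union> T (Suc l)) + f ((S \<union> T l) \<inter> T (Suc l)) \<le> f (S \<union> T l) + f (T (Suc l))"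
      using f_submod[of "S \<union> T l" "T (Suc l)"] s that eq by auto
    ultimately show ?thesis unfolding I_def eq f_def by (simp add: sum_subtractf)
  qed
  have I_zero: "I e l S = 0" if "e \<in> E" "l < L" "S \<subseteq> V" "d l = 0" for e l S
  proof -
    have s: "T l \<subseteq> T (Suc l)" "T (Suc l) \<subseteq> V" using strict TSV that by auto
    have "(\<Sum>e\<in>E. G e (T (Suc l)) - G e (T l)) = 0"
      using slope[OF that(2)] that(4) by (simp add: f_def sum_subtractf)
    then have "G e (T (Suc l)) - G e (T l) = 0"
      using sum_nonneg_eq_0_iff[OF fin(2), of "\<lambda>e. G e (T (Suc l)) - G e (T l)"] s G_mono that(1)
      by auto
    then show ?thesis using I_nonneg[OF that(1-3)] I_le[OF that(1-3)] by linarith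
  qed
  \<comment> \<open>Telescoping of the marginal value of \<open>S\<close> over \<open>T m\<close>:
    at \<open>m = 0\<close> it is \<open>G e S - G e {}\<close>, at \<open>m = L\<close> it is
    0.\<close>
  have G_decomp: "G e S = G e {} + (\<Sum>l<L. I e l S)" if "S \<subseteq> V" for e S
  proof -
    have "(\<Sum>l<m. I e l S) = (G e (S \<union> T 0) - G e (T 0)) - (G e (S \<union> T m) - G e (T m))" for m
      by (induction m) (auto simp: I_def)
    from this[of L] show ?thesis using T0 TL that by (simp add: Un_absorb1)
  qed

  \<comment> \<open>Chosen so that each unit of \<open>sum (a j) E\<close> divides the failure bound
    by \<open>16 * n\<^sup>2\<close>. The extra 1 in \<open>M\<close> pays for the empty
    set.\<close>
  define K where "K = 4 / \<epsilon>\<^sup>2 * ln (16 * (real n)\<^sup>2)"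
  define M where "M = K * (n + 1)"
  \<comment> \<open>\<open>None\<close> carries the value at the empty set, which no layer sees. Layers with \<open>d l = 0\<close> vanish,
    so division by zero is harmless.\<close>
  define a where "a = case_option (\<lambda>e. G e {} / f {}) (\<lambda>(i, A) e. \<Sum>l=i..<L. I e l A / d l)"
  \<comment> \<open>By \<open>I_le\<close>, this bounds \<open>K * a j e\<close> for all
    \<open>j\<close> at once.\<close>
  define q where "q e = K * (G e {} / f {} + (\<Sum>l<L. (G e (T (Suc l)) - G e (T l)) / d l))" for e
  \<comment> \<open>The empty \<open>A\<close> is excluded: its sum is 0, so its failure bound would
    be useless, while its error vanishes anyway.\<close>
  define J1 where "J1 = (SIGMA i:{i. i < L \<and> 0 < d i}. {A. A \<subseteq> V - T i \<and> A \<noteq> {}})"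
  define J where "J = Some ` J1 \<union> (if 0 < f {} then {None} else {})"
  have n16: "16 \<le> 16 * (real n)\<^sup>2" using n by simp
  have ln1: "1 \<le> ln (16 * (real n)\<^sup>2)"
  proof -
    have "exp 1 \<le> 16 * (real n)\<^sup>2" using exp_le n16 by linarith
    then show ?thesis using n by (subst ln_ge_iff) auto
  qed
  have K1: "1 \<le> K"
  proof -
    have "\<epsilon>\<^sup>2 \<le> 1" using eps by (simp add: power_le_one)
    then have "1 \<le> 4 / \<epsilon>\<^sup>2" using eps by (simp add: pos_le_divide_eq)
    then show ?thesis unfolding K_def using ln1 mult_mono[of 1 "4 / \<epsilon>\<^sup>2" 1 "ln (16 * (real n)\<^sup>2)"] by simp
  qed
  have finJ1: "finite J1" unfolding J1_def using fin(1) by (intro finite_SigmaI) auto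
  have incr: "0 \<le> G e (T (Suc l)) - G e (T l)" if "e \<in> E" "l < L" for e l
    using I_nonneg[OF that, of "{}"] I_le[OF that, of "{}"] by simp
  have marg: "0 \<le> (G e (T (Suc l)) - G e (T l)) / d l" if "e \<in> E" "l < L" for e l
    using incr[OF that] d_nonneg[OF that(2)] by simp
  have a_nonneg: "0 \<le> a j e" if "j \<in> J" "e \<in> E" for j e
    using that f_empty G_empty
    by (auto simp: J_def J1_def a_def intro!: sum_nonneg divide_nonneg_nonneg I_nonneg d_nonneg
        split: if_splits)
  have a_le: "K * a j e \<le> q e" if "j \<in> J" "e \<in> E" for j e
  proof -
    have G0: "0 \<le> G e {} / f {}" using G_empty f_empty that by simp
    have ms: "0 \<le> (\<Sum>l<L. (G e (T (Suc l)) - G e (T l)) / d l)"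
      by (rule sum_nonneg) (use marg that in auto)
    have "a j e \<le> G e {} / f {} + (\<Sum>l<L. (G e (T (Suc l)) - G e (T l)) / d l)"
    proof (cases j)
      case None
      then show ?thesis using ms by (simp add: a_def)
    next
      case (Some x)
      obtain i A where x: "j = Some (i, A)" "i < L" "A \<subseteq> V"
        using \<open>j \<in> J\<close> Some by (cases x) (auto simp: J_def J1_def split: if_splits)
      have "a j e \<le> (\<Sum>l=i..<L. (G e (T (Suc l)) - G e (T l)) / d l)"
        unfolding a_def x(1) option.case prod.case
        by (intro sum_mono divide_right_mono I_le d_nonneg) (use that x in auto)
      also have "\<dots> \<le> (\<Sum>l<L. (G e (T (Suc l)) - G e (T l)) / d l)"
        by (rule sum_mono2) (use marg that in auto)
      finally show ?thesis using G0 by linarith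
    qed
    then show ?thesis unfolding q_def using K1 by (intro mult_left_mono) auto
  qed
  have q_nonneg: "0 \<le> q e" if "e \<in> E" for e
    unfolding q_def using K1 G_empty[OF that] f_empty marg that
    by (intro mult_nonneg_nonneg add_nonneg_nonneg sum_nonneg) auto
  \<comment> \<open>After division by \<open>d l\<close>, layer \<open>l\<close> contributes its
    number of vertices, or 0 if \<open>d l = 0\<close>.\<close>
  have q_sum: "sum q E \<le> M"
  proof -
    have "(\<Sum>e\<in>E. \<Sum>l<L. (G e (T (Suc l)) - G e (T l)) / d l)
        = (\<Sum>l<L. (f (T (Suc l)) - f (T l)) / d l)"
      by (subst sum.swap) (simp add: f_def sum_subtractf flip: sum_divide_distrib)
    also have "\<dots> \<le> (\<Sum>l<L. real (card (T (Suc l) - T l)))"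
      by (rule sum_mono) (use slope in auto)
    also have "\<dots> = n" using card_telescope[of L] TL by (simp add: n_def flip: of_nat_sum)
    finally have "(\<Sum>e\<in>E. \<Sum>l<L. (G e (T (Suc l)) - G e (T l)) / d l) \<le> n" .
    moreover have "(\<Sum>e\<in>E. G e {} / f {}) \<le> 1"
      by (simp add: f_def flip: sum_divide_distrib)
    ultimately show ?thesis unfolding q_def M_def using K1
      by (simp add: sum.distrib flip: sum_distrib_left)
  qed
  have F_ge: "card A \<le> sum (a (Some (i, A))) E" if "(i, A) \<in> J1" for i A
  proof -
    have i: "i < L" "0 < d i" and A: "A \<subseteq> V - T i" using that unfolding J1_def by auto
    have dpos: "0 < d l" if "i \<le> l" "l < L" for l
      using that by (induction l rule: dec_induct) (use i d_mono in force)+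
    have "A = (\<Union>l\<in>{i..<L}. A \<inter> (T (Suc l) - T l))"
    proof -
      have "T m - T i \<subseteq> (\<Union>l\<in>{i..<m}. T (Suc l) - T l)" if "i \<le> m" for m
        using that
      proof (induction m rule: dec_induct)
        case base then show ?case by simp
      next
        case (step m)
        then have "T (Suc m) - T i \<subseteq> (T (Suc m) - T m) \<union> (T m - T i)" by auto
        then show ?case using step by (force simp: less_Suc_eq)
      qed
      from this[of L] show ?thesis using A TL i by fastforce
    qed
    then have "real (card A) \<le> (\<Sum>l=i..<L. real (card (A \<inter> (T (Suc l) - T l))))"
      using card_UN_le[of "{i..<L}" "\<lambda>l. A \<inter> (T (Suc l) - T l)"]
      by (metis finite_atLeastLessThan of_nat_le_iff of_nat_sum)
    also have "\<dots> \<le> (\<Sum>l=i..<L. (\<Sum>e\<in>E. I e l A) / d l)"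
    proof (rule sum_mono)
      fix l assume l: "l \<in> {i..<L}"
      then show "real (card (A \<inter> (T (Suc l) - T l))) \<le> (\<Sum>e\<in>E. I e l A) / d l"
        using I_sum[of l A] A dpos[of l] by (auto simp: pos_le_divide_eq mult.commute)
    qed
    also have "\<dots> = sum (a (Some (i, A))) E"
      unfolding a_def sum_divide_distrib by (subst sum.swap) simp
    finally show ?thesis .
  qed
  define z where "z = 1 / (16 * (real n)\<^sup>2)"
  have z_eq: "exp (- (\<epsilon>\<^sup>2 * K * x / 4)) = exp (- (ln (16 * (real n)\<^sup>2) * x))" for x
    using eps by (simp add: K_def)
  have z_exp: "exp (- (ln (16 * (real n)\<^sup>2))) = z"
    using n by (simp add: exp_minus z_def inverse_eq_divide)
  have z_bound: "exp (- (\<epsilon>\<^sup>2 * K * sum (a (Some (i, A))) E / 4)) \<le> z ^ card A" if "(i, A) \<in> J1" for i A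
  proof -
    have "exp (- (\<epsilon>\<^sup>2 * K * sum (a (Some (i, A))) E / 4)) \<le> exp (- (ln (16 * (real n)\<^sup>2) * card A))"
      unfolding z_eq using F_ge[OF that] ln1 by (simp add: mult_left_mono)
    also have "\<dots> = z ^ card A"
      by (simp add: mult.commute flip: z_exp exp_of_nat_mult)
    finally show ?thesis .
  qed
  have z0: "0 < z" "z \<le> 1 / 16" using n n16 by (auto simp: z_def field_simps)
  have nz: "n * z = 1 / (16 * n)" using n by (simp add: z_def power2_eq_square)
  \<comment> \<open>The sum is \<open>(1 + z) ^ n - 1\<close>, at most
    \<open>exp (n * z) - 1\<close>, where \<open>n * z \<le> 1 / 16\<close>.\<close>
  have Pow_sum: "(\<Sum>A\<in>Pow V - {{}}. z ^ card A) \<le> 2 * (n * z)"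
  proof -
    have "(\<Sum>A\<in>Pow V - {{}}. z ^ card A) = (1 + z) ^ n - 1"
      using fin(1) sum_Pow_power_card[OF fin(1), of z] by (simp add: sum_diff1 n_def)
    also have "(1 + z) ^ n \<le> exp z ^ n" using z0 by (intro power_mono) auto
    also have "\<dots> = exp (n * z)" by (simp add: exp_of_nat_mult)
    also have "\<dots> \<le> 1 + n * z + (n * z)\<^sup>2" using z0 nz n by (intro exp_bound) auto
    also have "(n * z)\<^sup>2 \<le> n * z"
      unfolding power2_eq_square using z0 nz n by (intro mult_left_le) auto
    finally show ?thesis by (simp add: mult.commute)
  qed
  \<comment> \<open>The budget is 1/4 for \<open>J1\<close>, where each of at most \<open>n\<close>
    indices \<open>i\<close> costs \<open>4 * n * z = 1 / (4 * n)\<close>, then 1/8 for the empty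
    set and 1/2 for the size: 7/8 in total.\<close>
  have small: "(\<Sum>j\<in>J. 2 * exp (- (\<epsilon>\<^sup>2 * K * sum (a j) E / 4))) + exp (- M) < 1"
  proof -
    let ?g = "\<lambda>j. 2 * exp (- (\<epsilon>\<^sup>2 * K * sum (a j) E / 4))"
    have "(\<Sum>x\<in>J1. ?g (Some x)) \<le> (\<Sum>(i, A)\<in>J1. 2 * z ^ card A)"
      by (rule sum_mono) (use z_bound in auto)
    also have "\<dots> \<le> (\<Sum>(i, A)\<in>{..<L} \<times> (Pow V - {{}}). 2 * z ^ card A)"
      by (rule sum_mono2) (use fin z0 in \<open>auto simp: J1_def\<close>)
    also have "\<dots> = L * (2 * (\<Sum>A\<in>Pow V - {{}}. z ^ card A))"
      by (simp add: sum.cartesian_product[symmetric] sum_distrib_left)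
    also have "\<dots> \<le> n * (2 * (2 * (n * z)))"
      using Ln Pow_sum z0 by (intro mult_mono) (auto intro!: sum_nonneg)
    also have "\<dots> = 1 / 4" unfolding nz using n by simp
    finally have 1: "(\<Sum>x\<in>J1. ?g (Some x)) \<le> 1 / 4" .
    have 2: "?g None \<le> 1 / 8" if "0 < f {}"
    proof -
      have "sum (a None) E = 1" using that by (simp add: a_def f_def flip: sum_divide_distrib)
      then show ?thesis using z_eq[of 1] z_exp z0 by simp
    qed
    have "sum ?g J = (\<Sum>x\<in>J1. ?g (Some x)) + (if 0 < f {} then ?g None else 0)"
      unfolding J_def using finJ1 by (subst sum.union_disjoint) (auto simp: sum.reindex)
    then have J: "sum ?g J \<le> 3 / 8" using 1 2 by (auto split: if_splits)
    have "1 \<le> M" unfolding M_def using K1 mult_mono[of 1 K 1 "real (n + 1)"] by simp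
    then have "exp (- M) \<le> exp (- 1)" by simp
    also have "\<dots> \<le> 1 / 2" using exp_ge_add_one_self[of "1 :: real"] by (simp add: exp_minus field_simps)
    finally show ?thesis using J by linarith
  qed
  have "finite J" using finJ1 by (auto simp: J_def)
  from importance_sampling[OF fin(2) this eps _ a_nonneg a_le q_nonneg q_sum small] K1
  have "\<exists>r. (\<forall>e. 0 \<le> r e) \<and> card {e\<in>E. r e \<noteq> 0} \<le> 4 * M \<and>
    (\<forall>j\<in>J. \<bar>(\<Sum>e\<in>E. r e * a j e) - sum (a j) E\<bar> \<le> \<epsilon> * sum (a j) E)" by simp
  then obtain r where r_nonneg: "\<forall>e. 0 \<le> r e" and r_card: "card {e\<in>E. r e \<noteq> 0} \<le> 4 * M"
    and r_err: "\<forall>j\<in>J. \<bar>(\<Sum>e\<in>E. r e * a j e) - sum (a j) E\<bar> \<le> \<epsilon> * sum (a j) E"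
    by (elim exE conjE) (rule that)
  have const: "\<bar>(\<Sum>e\<in>E. r e * G e {}) - f {}\<bar> \<le> \<epsilon> * f {}"
  proof (cases "0 < f {}")
    case True
    have eq: "sum (a None) E = 1" using True by (simp add: a_def f_def flip: sum_divide_distrib)
    have "\<bar>(\<Sum>e\<in>E. r e * G e {}) / f {} - 1\<bar> \<le> \<epsilon>"
      using bspec[OF r_err, of None] True eq by (simp add: J_def a_def sum_divide_distrib)
    then show ?thesis using True by (simp add: abs_le_iff field_simps)
  next
    case False
    then have "f {} = 0" using f_empty by simp
    then have "\<forall>e\<in>E. G e {} = 0" unfolding f_def using G_empty fin by (subst (asm) sum_nonneg_eq_0_iff) auto
    then show ?thesis using \<open>f {} = 0\<close> by simp
  qed
  \<comment> \<open>Each tail of the terms without the factor \<open>d l\<close> is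
    \<open>\<epsilon>\<close> times a sampled sum plus its signed error, hence nonnegative.
    Summation by parts restores the increasing weights \<open>d l\<close>.\<close>
  have layers: "0 \<le> (\<Sum>l<L. d l * ((\<epsilon> * (\<Sum>e\<in>E. I e l S) + s * (\<Sum>e\<in>E. (r e - 1) * I e l S)) / d l))"
    if S: "S \<subseteq> V" and s: "s \<in> {1, -1}" for S s
  proof (rule weighted_tail_sum_nonneg[where w = d, OF _ d_mono d_nonneg])
    fix i assume i: "i < L" "0 < d i"
    define A where "A = S - T i"
    \<comment> \<open>Layers from \<open>i\<close> on see only the part of \<open>S\<close> outside
      \<open>T i\<close>, so the sampled family need only range over such sets.\<close>
    have IA: "I e l S = I e l A" if "i \<le> l" "l < L" for e l
    proof -
      have "S \<union> T l = A \<union> T l" "S \<union> T (Suc l) = A \<union> T (Suc l)"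
        using T_mono[of i l] T_mono[of i "Suc l"] that unfolding A_def by auto
      then show ?thesis unfolding I_def by simp
    qed
    have "(\<Sum>l=i..<L. (\<epsilon> * (\<Sum>e\<in>E. I e l S) + s * (\<Sum>e\<in>E. (r e - 1) * I e l S)) / d l)
      = (\<Sum>l=i..<L. \<Sum>e\<in>E. (\<epsilon> + s * (r e - 1)) * (I e l A / d l))"
      using IA by (intro sum.cong)
        (auto simp: sum_distrib_left sum_divide_distrib sum.distrib[symmetric] add_divide_distrib
          diff_divide_distrib algebra_simps)
    also have "\<dots> = (\<Sum>e\<in>E. (\<epsilon> + s * (r e - 1)) * a (Some (i, A)) e)"
      unfolding a_def by (subst sum.swap) (simp add: sum_distrib_left)
    also have "\<dots> = \<epsilon> * sum (a (Some (i, A))) E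
        + s * ((\<Sum>e\<in>E. r e * a (Some (i, A)) e) - sum (a (Some (i, A))) E)"
      by (simp add: sum_distrib_left sum.distrib[symmetric] sum_subtractf[symmetric] algebra_simps)
    also have "\<dots> \<ge> 0"
    proof (cases "A = {}")
      case True
      then show ?thesis by (simp add: a_def I_def)
    next
      case False
      then have "Some (i, A) \<in> J" using i S unfolding J_def J1_def A_def by auto
      from bspec[OF r_err this] s show ?thesis by (auto simp: abs_le_iff)
    qed
    finally show "0 \<le> (\<Sum>l=i..<L. (\<epsilon> * (\<Sum>e\<in>E. I e l S) + s * (\<Sum>e\<in>E. (r e - 1) * I e l S)) / d l)" .
  qed
  have err: "\<bar>(\<Sum>e\<in>E. r e * G e S) - f S\<bar> \<le> \<epsilon> * f S" if S: "S \<subseteq> V" for S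
  proof -
    \<comment> \<open>For \<open>d l = 0\<close> the left side is 0 by the convention on division,
      and the right side is 0 by \<open>I_zero\<close>.\<close>
    have canc: "d l * ((\<epsilon> * (\<Sum>e\<in>E. I e l S) + s * (\<Sum>e\<in>E. (r e - 1) * I e l S)) / d l)
      = \<epsilon> * (\<Sum>e\<in>E. I e l S) + s * (\<Sum>e\<in>E. (r e - 1) * I e l S)" if "l < L" for l s
      by (cases "d l = 0") (use I_zero that S in auto)
    define P where "P = (\<Sum>l<L. \<Sum>e\<in>E. I e l S)"
    define D where "D = (\<Sum>l<L. \<Sum>e\<in>E. (r e - 1) * I e l S)"
    have "0 \<le> \<epsilon> * P + s * D" if "s \<in> {1, -1}" for s
      using layers[OF S that] canc by (simp add: P_def D_def sum.distrib sum_distrib_left)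
    from this[of 1] this[of "-1"] have PD: "\<bar>D\<bar> \<le> \<epsilon> * P" by (simp add: abs_le_iff)
    have fS: "f S = f {} + P"
      unfolding f_def P_def by (subst sum.swap[of _ E "{..<L}"]) (simp add: G_decomp[OF S] sum.distrib)
    have "(\<Sum>e\<in>E. r e * G e S) - f S = (\<Sum>e\<in>E. (r e - 1) * G e S)"
      by (simp add: f_def sum_subtractf algebra_simps)
    also have "\<dots> = (\<Sum>e\<in>E. (r e - 1) * G e {}) + D"
      unfolding D_def by (subst sum.swap[of _ E "{..<L}"])
        (simp add: G_decomp[OF S] sum.distrib distrib_left sum_distrib_left)
    also have "(\<Sum>e\<in>E. (r e - 1) * G e {}) = (\<Sum>e\<in>E. r e * G e {}) - f {}"
      by (simp add: f_def sum_subtractf algebra_simps)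
    finally show ?thesis using const PD fS by (simp add: abs_le_iff distrib_left)
  qed
  have M_eq: "4 * M = 16 / \<epsilon>\<^sup>2 * ln (16 * (card V)\<^sup>2) * (card V + 1)"
    by (simp add: M_def K_def n_def)
  show ?thesis
  proof (intro exI[of _ r] conjI allI impI)
    show "\<bar>(\<Sum>e\<in>E. r e * G e S) - (\<Sum>e\<in>E. G e S)\<bar> \<le> \<epsilon> * (\<Sum>e\<in>E. G e S)" if "S \<subseteq> V" for S
      using err[OF that] unfolding f_def .
    show "card {e\<in>E. r e \<noteq> 0} \<le> 16 / \<epsilon>\<^sup>2 * ln (16 * (card V)\<^sup>2) * (card V + 1)"
      using r_card unfolding M_eq .
  qed (rule r_nonneg[rule_format])
qed

section \<open>The cut sparsifier of a hypergraph\<close>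

theorem theorem1p6:
  "\<exists>(C::real) (k::nat). \<forall>(H::('v, 'e) hypergraph) (n::nat) (\<epsilon>::real).
     submodular_hypergraph H \<and> card (verts H) = n \<and> n \<ge> 1 \<and>
     (\<forall>e\<in>edges H. monotone_splitting_on (ends H e) (split H e)) \<and>
     0 < \<epsilon> \<and> \<epsilon> < 1 \<longrightarrow>
     (\<exists>H'. cut_sparsifier \<epsilon> H H' \<and>
        real (card (edges H')) \<le> C * (real n / \<epsilon>\<^sup>2) * (1 + ln (real n / \<epsilon>\<^sup>2)) ^ k)"
\<comment> \<open>The constant is \<open>16 * 4 * 2\<close>: 16 from the sparsifier bound, 4 from
  \<open>ln (16 * n\<^sup>2) \<le> 4 * (1 + ln (n / \<epsilon>\<^sup>2))\<close>, and 2 from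
  \<open>n + 1 \<le> 2 * n\<close>.\<close>
proof (intro exI[of _ "128 :: real"] exI[of _ "1 :: nat"] allI impI)
  fix H :: "('v, 'e) hypergraph" and n :: nat and \<epsilon> :: real
  assume *: "submodular_hypergraph H \<and> card (verts H) = n \<and> n \<ge> 1 \<and>
     (\<forall>e\<in>edges H. monotone_splitting_on (ends H e) (split H e)) \<and> 0 < \<epsilon> \<and> \<epsilon> < 1"
  define V where "V = verts H"
  define E where "E = edges H"
  define G where "G e S = weight H e * split H e (S \<inter> ends H e)" for e S
  have fin: "finite V" "finite E" and cV: "card V = n" and n: "1 \<le> n" and eps: "0 < \<epsilon>" "\<epsilon> < 1"
    using * unfolding submodular_hypergraph_def V_def E_def by auto
  have edge: "ends H e \<subseteq> V" "0 \<le> weight H e" "\<And>S. S \<subseteq> ends H e \<Longrightarrow> 0 \<le> split H e S"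
      "submodular_on (ends H e) (split H e)" "monotone_splitting_on (ends H e) (split H e)"
    if "e \<in> E" for e
    using * that unfolding submodular_hypergraph_def V_def E_def by auto
  have "V \<noteq> {}" using cV n by auto
  moreover have "0 \<le> G e {}" if "e \<in> E" for e
    using edge[OF that] by (simp add: G_def)
  moreover have "G e A \<le> G e B" if "e \<in> E" "A \<subseteq> B" "B \<subseteq> V" for e A B
    unfolding G_def using edge[OF that(1)] that
    by (intro mult_left_mono edge(5)[OF that(1), unfolded monotone_splitting_on_def, rule_format]) auto
  moreover have "G e (A \<union> B) + G e (A \<inter> B) \<le> G e A + G e B" if "e \<in> E" for e A B
  proof -
    have "finite (ends H e)" using edge(1)[OF that] fin(1) by (rule finite_subset)
    from submodular_on_lattice[OF edge(4)[OF that] this, of "A \<inter> ends H e" "B \<inter> ends H e"]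
    have "split H e ((A \<union> B) \<inter> ends H e) + split H e ((A \<inter> B) \<inter> ends H e)
        \<le> split H e (A \<inter> ends H e) + split H e (B \<inter> ends H e)"
      unfolding Int_Un_distrib2 by (simp add: Int_ac)
    from mult_left_mono[OF this edge(2)[OF that]] show ?thesis by (simp add: G_def distrib_left)
  qed
  ultimately have "\<exists>r. (\<forall>e. 0 \<le> r e) \<and>
    card {e\<in>E. r e \<noteq> 0} \<le> 16 / \<epsilon>\<^sup>2 * ln (16 * (card V)\<^sup>2) * (card V + 1) \<and>
    (\<forall>S\<subseteq>V. \<bar>(\<Sum>e\<in>E. r e * G e S) - (\<Sum>e\<in>E. G e S)\<bar> \<le> \<epsilon> * (\<Sum>e\<in>E. G e S))"
    by (intro monotone_submodular_sum_sparsifier fin eps)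
  then obtain r where r_nonneg: "\<forall>e. 0 \<le> r e"
    and r_card: "card {e\<in>E. r e \<noteq> 0} \<le> 16 / \<epsilon>\<^sup>2 * ln (16 * (card V)\<^sup>2) * (card V + 1)"
    and r_err: "\<forall>S\<subseteq>V. \<bar>(\<Sum>e\<in>E. r e * G e S) - (\<Sum>e\<in>E. G e S)\<bar> \<le> \<epsilon> * (\<Sum>e\<in>E. G e S)"
    by (elim exE conjE) (rule that)
  \<comment> \<open>Hyperedges with \<open>r e = 0\<close> are removed, so the size bound counts
    only the support of \<open>r\<close>, and the cut loses only zero terms.\<close>
  define H' where "H' = H\<lparr>edges := {e\<in>E. r e \<noteq> 0}, weight := \<lambda>e. r e * weight H e\<rparr>"
  have cutH: "cut H S = (\<Sum>e\<in>E. G e S)" for S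
    by (simp add: cut_def G_def E_def)
  have cutH': "cut H' S = (\<Sum>e\<in>E. r e * G e S)" for S
    unfolding cut_def H'_def G_def using fin(2)
    by (auto simp: mult.assoc intro!: sum.mono_neutral_left)
  have "cut_sparsifier \<epsilon> H H'"
    unfolding cut_sparsifier_def
  proof (intro conjI allI impI ballI)
    fix S assume "S \<subseteq> verts H"
    from r_err[rule_format, OF this[folded V_def]]
    show "(1 - \<epsilon>) * cut H S \<le> cut H' S" "cut H' S \<le> (1 + \<epsilon>) * cut H S"
      unfolding cutH cutH' by (auto simp: abs_le_iff algebra_simps)
  qed (use r_nonneg edge(2) in \<open>auto simp: H'_def E_def\<close>)
  moreover have "real (card (edges H')) \<le> 128 * (real n / \<epsilon>\<^sup>2) * (1 + ln (real n / \<epsilon>\<^sup>2)) ^ 1"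
  proof -
    have "real n \<le> real n / \<epsilon>\<^sup>2" using eps n by (simp add: pos_le_divide_eq power_le_one mult_left_le)
    then have ln_le: "ln n \<le> ln (real n / \<epsilon>\<^sup>2)" using n by (subst ln_le_cancel_iff) auto
    have ln0: "0 \<le> ln (real n)" using n by simp
    have "ln (16 :: real) = 4 * ln 2" using ln_realpow[of "2 :: real" 4] by simp
    then have "ln (16 :: real) \<le> 4" using ln_2_less_1 by simp
    moreover have "ln (16 * (real n)\<^sup>2) = ln 16 + 2 * ln n"
      using n by (simp add: ln_mult ln_realpow)
    ultimately have "ln (16 * (real n)\<^sup>2) \<le> 4 * (1 + ln (real n / \<epsilon>\<^sup>2))"
      using ln_le ln0 unfolding distrib_left by linarith
    then have "ln (16 * (real n)\<^sup>2) * (n + 1) \<le> 4 * (1 + ln (real n / \<epsilon>\<^sup>2)) * (2 * n)"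
    proof (rule mult_mono)
      show "0 \<le> 4 * (1 + ln (real n / \<epsilon>\<^sup>2))"
        using ln_le ln0 unfolding distrib_left by linarith
    qed (use n in auto)
    from mult_left_mono[OF this, of "16 / \<epsilon>\<^sup>2"]
    have "16 / \<epsilon>\<^sup>2 * ln (16 * (real n)\<^sup>2) * (n + 1) \<le> 128 * (real n / \<epsilon>\<^sup>2) * (1 + ln (real n / \<epsilon>\<^sup>2))"
      by (simp add: mult_ac)
    then show ?thesis using r_card by (simp add: H'_def cV)
  qed
  ultimately show "\<exists>H'. cut_sparsifier \<epsilon> H H' \<and>
      real (card (edges H')) \<le> 128 * (real n / \<epsilon>\<^sup>2) * (1 + ln (real n / \<epsilon>\<^sup>2)) ^ 1" by blast
qed

end
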